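(* Let $M=(E,\mathcal I)$ be a matroid with weights $\sigma\in\mathbb R^E_{>0}$. (1) For any set $H\subseteq E$ such that $\operatorname{cl}(H)\ne E$, we have $S_\sigma(M\setminus H)\le S_\sigma(M/H)$. (2) For any set $H\subseteq E$ such that $\operatorname{cl}(H)\ne E$, we have $D_\sigma(M\setminus H)\le D_\sigma(M/H)$.
   Context: The matroid $M$ is finite, loopless and of positive rank, with rank function $r$ and closure operator $\operatorname{cl}$. For $X\subseteq E$, $\sigma(X)=\sum_{e\in X}\sigma(e)$. For a matroid of positive rank with ground set $E$, rank function $r$ and weights $\sigma$, $$S_\sigma(M)=\min\Big\{\tfrac{\sigma(X)}{r(E)-r(E-X)}:X\subseteq E,\ r(E)>r(E-X)\Big\},\qquad D_\sigma(M)=\max\Big\{\tfrac{\sigma(X)}{r(X)}:X\subseteq E,\ r(X)>0\Big\}.$$ Minors carry the restricted weights. $M\setminus H$ is the deletion of $H$ and $M/H$ the contraction of $H$; both are matroids on $E-H$, with rank functions $r_{M\setminus H}(Y)=r(Y)$ and $r_{M/H}(Y)=r(H\cup Y)-r(H)$. *)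

theory Defs
  imports Complex_Main
begin

record 'a set_system =
  ground :: "'a set"
  indep :: "'a set set"

locale matroid =
  fixes M :: "'a set_system"
  assumes finite_ground: "finite (ground M)"
    and indep_subset_ground: "I \<in> indep M \<Longrightarrow> I \<subseteq> ground M"
    and empty_indep: "{} \<in> indep M"
    and indep_mono: "I \<in> indep M \<Longrightarrow> J \<subseteq> I \<Longrightarrow> J \<in> indep M"
    and augment: "I \<in> indep M \<Longrightarrow> J \<in> indep M \<Longrightarrow> card I < card J \<Longrightarrow>
                    \<exists>e\<in>J - I. insert e I \<in> indep M"

definition mrank :: "'a set_system \<Rightarrow> 'a set \<Rightarrow> nat" where
  "mrank M X = Max (card ` {I \<in> indep M. I \<subseteq> X})"

definition mclosure :: "'a set_system \<Rightarrow> 'a set \<Rightarrow> 'a set" where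
  "mclosure M X = {e \<in> ground M. mrank M (insert e X) = mrank M X}"

definition loopless :: "'a set_system \<Rightarrow> bool" where
  "loopless M \<longleftrightarrow> (\<forall>e\<in>ground M. {e} \<in> indep M)"

definition deletion :: "'a set_system \<Rightarrow> 'a set \<Rightarrow> 'a set_system" where
  "deletion M H = \<lparr>ground = ground M - H, indep = {I \<in> indep M. I \<subseteq> ground M - H}\<rparr>"

text \<open>The contraction is the matroid on the complement of \<open>H\<close> whose rank function is
  \<open>Y \<mapsto> r(H \<union> Y) - r(H)\<close>; its independent sets are those whose size equals that rank.
  See \<open>mrank_contraction\<close> below.\<close>

definition contraction :: "'a set_system \<Rightarrow> 'a set \<Rightarrow> 'a set_system" where
  "contraction M H = \<lparr>ground = ground M - H,
     indep = {I. I \<subseteq> ground M - H \<and> mrank M (H \<union> I) = mrank M H + card I}\<rparr>"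

text \<open>Weights are total functions of which only the values on the ground set matter, so a minor
  carries the restricted weights without an explicit restriction. The two quantities below are
  meaningful for matroids of positive rank, where \<open>Min\<close> and \<open>Max\<close> range over finite nonempty sets.\<close>

definition strength :: "('a \<Rightarrow> real) \<Rightarrow> 'a set_system \<Rightarrow> real" where
  "strength \<sigma> M =
     Min {sum \<sigma> X / (real (mrank M (ground M)) - real (mrank M (ground M - X))) | X.
            X \<subseteq> ground M \<and> mrank M (ground M) > mrank M (ground M - X)}"

definition max_density :: "('a \<Rightarrow> real) \<Rightarrow> 'a set_system \<Rightarrow> real" where
  "max_density \<sigma> M =
     Max {sum \<sigma> X / real (mrank M X) | X. X \<subseteq> ground M \<and> mrank M X > 0}"

lemma (in matroid) indep_finite: "I \<in> indep M \<Longrightarrow> finite I"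
  using indep_subset_ground finite_ground finite_subset by blast

lemma (in matroid) finite_indep_sets: "finite {I \<in> indep M. I \<subseteq> X}"
  by (rule finite_subset[of _ "Pow (ground M)"]) (use indep_subset_ground finite_ground in auto)

lemma (in matroid) card_le_mrank: "I \<in> indep M \<Longrightarrow> I \<subseteq> X \<Longrightarrow> card I \<le> mrank M X"
  unfolding mrank_def by (rule Max_ge) (use finite_indep_sets[of X] in auto)

lemma (in matroid) ex_basis: "\<exists>B\<in>indep M. B \<subseteq> X \<and> card B = mrank M X"
proof -
  have "mrank M X \<in> card ` {I \<in> indep M. I \<subseteq> X}"
    unfolding mrank_def by (rule Max_in) (use finite_indep_sets[of X] empty_indep in auto)
  then show ?thesis by auto
qed

lemma (in matroid) mrank_mono: "X \<subseteq> Y \<Longrightarrow> mrank M X \<le> mrank M Y"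
  using ex_basis[of X] card_le_mrank[of _ Y] by fastforce

lemma (in matroid) extend_to_basis:
  assumes "I \<in> indep M" "I \<subseteq> X"
  shows "\<exists>B\<in>indep M. I \<subseteq> B \<and> B \<subseteq> X \<and> card B = mrank M X"
  using assms
proof (induction "mrank M X - card I" arbitrary: I rule: less_induct)
  case less
  show ?case
  proof (cases "card I = mrank M X")
    case True
    then show ?thesis using less.prems by blast
  next
    case False
    then have lt: "card I < mrank M X" using card_le_mrank[OF less.prems] by simp
    obtain J where J: "J \<in> indep M" "J \<subseteq> X" "card J = mrank M X" using ex_basis by blast
    obtain e where e: "e \<in> J - I" "insert e I \<in> indep M"
      using augment[OF less.prems(1) J(1)] lt J(3) by auto
    have "card (insert e I) = Suc (card I)" using e indep_finite[OF less.prems(1)] by simp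
    then have "\<exists>B\<in>indep M. insert e I \<subseteq> B \<and> B \<subseteq> X \<and> card B = mrank M X"
      using less.hyps[of "insert e I"] lt e J(2) less.prems by auto
    then show ?thesis by blast
  qed
qed

lemma (in matroid) basis_extension_Int:
  assumes "B \<in> indep M" "B \<subseteq> H" "card B = mrank M H" "C \<in> indep M" "B \<subseteq> C"
  shows "C \<inter> H = B"
proof -
  have "C \<inter> H \<in> indep M" using indep_mono assms(4) by blast
  then have "finite (C \<inter> H)" "card (C \<inter> H) \<le> card B"
    using card_le_mrank[of "C \<inter> H" H] assms(3) indep_finite by auto
  then show ?thesis using card_seteq[of "C \<inter> H" B] assms by auto
qed

lemma (in matroid) contraction_indep_iff:
  assumes "B \<in> indep M" "B \<subseteq> H" "card B = mrank M H"
  shows "I \<in> indep (contraction M H) \<longleftrightarrow> I \<subseteq> ground M - H \<and> B \<union> I \<in> indep M"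
proof (cases "I \<subseteq> ground M - H")
  case True
  then have fin: "finite I" using finite_ground finite_subset by blast
  have disj: "B \<inter> I = {}" using True assms(2) by blast
  have cBI: "card (B \<union> I) = mrank M H + card I"
    using card_Un_disjoint[OF indep_finite[OF assms(1)] fin disj] assms(3) by simp
  obtain C where C: "C \<in> indep M" "B \<subseteq> C" "C \<subseteq> H \<union> I" "card C = mrank M (H \<union> I)"
    using extend_to_basis[OF assms(1), of "H \<union> I"] assms(2) by blast
  have CH: "C \<inter> H = B" using basis_extension_Int[OF assms C(1,2)] .
  have sub: "C \<subseteq> B \<union> I" using CH C(3) by blast
  have finBI: "finite (B \<union> I)" using fin indep_finite[OF assms(1)] by simp
  have "mrank M (H \<union> I) = mrank M H + card I \<longleftrightarrow> B \<union> I \<in> indep M"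
  proof
    assume "mrank M (H \<union> I) = mrank M H + card I"
    then have "C = B \<union> I" using card_subset_eq[OF finBI sub] C(4) cBI by simp
    then show "B \<union> I \<in> indep M" using C(1) by simp
  next
    assume "B \<union> I \<in> indep M"
    then have "card (B \<union> I) \<le> mrank M (H \<union> I)" using card_le_mrank assms(2) by blast
    then show "mrank M (H \<union> I) = mrank M H + card I"
      using card_mono[OF finBI sub] C(4) cBI by simp
  qed
  then show ?thesis using True by (simp add: contraction_def)
qed (simp add: contraction_def)

lemma matroid_deletion:
  assumes "matroid M"
  shows "matroid (deletion M H)"
proof -
  interpret matroid M by fact
  show ?thesis
  proof
    fix I J
    assume I: "I \<in> indep (deletion M H)" and J: "J \<in> indep (deletion M H)" and "card I < card J"
    then obtain e where "e \<in> J - I" "insert e I \<in> indep M"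
      using augment[of I J] by (auto simp: deletion_def)
    then show "\<exists>e\<in>J - I. insert e I \<in> indep (deletion M H)"
      using I J by (intro bexI[of _ e]) (auto simp: deletion_def)
  qed (use finite_ground empty_indep indep_mono in \<open>auto simp: deletion_def\<close>)
qed

lemma mrank_deletion:
  assumes "Y \<subseteq> ground M - H"
  shows "mrank (deletion M H) Y = mrank M Y"
proof -
  have "{I \<in> indep (deletion M H). I \<subseteq> Y} = {I \<in> indep M. I \<subseteq> Y}"
    using assms by (auto simp: deletion_def)
  then show ?thesis by (simp add: mrank_def)
qed

lemma matroid_contraction:
  assumes "matroid M"
  shows "matroid (contraction M H)"
proof -
  interpret matroid M by fact
  obtain B where B: "B \<in> indep M" "B \<subseteq> H" "card B = mrank M H" using ex_basis by blast
  note iff = contraction_indep_iff[OF B]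
  show ?thesis
  proof
    show "finite (ground (contraction M H))" using finite_ground by (simp add: contraction_def)
    show "I \<subseteq> ground (contraction M H)" if "I \<in> indep (contraction M H)" for I
      using that by (simp add: contraction_def)
    show "{} \<in> indep (contraction M H)" by (simp add: iff B)
    show "J \<in> indep (contraction M H)" if "I \<in> indep (contraction M H)" "J \<subseteq> I" for I J
      using that indep_mono[of "B \<union> I" "B \<union> J"] by (auto simp: iff)
  next
    fix I J
    assume I: "I \<in> indep (contraction M H)" and J: "J \<in> indep (contraction M H)"
      and lt: "card I < card J"
    have fin: "finite B" "finite I" "finite J"
      using I J B(1) indep_finite[of "B \<union> I"] indep_finite[of "B \<union> J"] by (auto simp: iff)
    have "B \<inter> I = {}" "B \<inter> J = {}" using I J B(2) by (auto simp: iff)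
    then have "card (B \<union> I) < card (B \<union> J)" using lt fin by (simp add: card_Un_disjoint)
    then obtain e where e: "e \<in> (B \<union> J) - (B \<union> I)" "insert e (B \<union> I) \<in> indep M"
      using augment[of "B \<union> I" "B \<union> J"] I J by (auto simp: iff)
    then show "\<exists>e\<in>J - I. insert e I \<in> indep (contraction M H)"
      using I J by (intro bexI[of _ e]) (auto simp: iff)
  qed
qed

lemma mrank_contraction:
  assumes "matroid M" "Y \<subseteq> ground M - H"
  shows "mrank (contraction M H) Y = mrank M (H \<union> Y) - mrank M H"
proof -
  interpret matroid M by fact
  interpret N: matroid "contraction M H" by (rule matroid_contraction) fact
  obtain B where B: "B \<in> indep M" "B \<subseteq> H" "card B = mrank M H" using ex_basis by blast
  obtain C where C: "C \<in> indep M" "B \<subseteq> C" "C \<subseteq> H \<union> Y" "card C = mrank M (H \<union> Y)"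
    using extend_to_basis[OF B(1), of "H \<union> Y"] B(2) by blast
  have CH: "C \<inter> H = B" using basis_extension_Int[OF B C(1,2)] .
  have "B \<union> (C - H) = C" using CH by blast
  then have "C - H \<in> indep (contraction M H)"
    using contraction_indep_iff[OF B, of "C - H"] C assms(2) by auto
  then have "card (C - H) \<le> mrank (contraction M H) Y" using N.card_le_mrank C(3) by blast
  moreover have "card (C - H) = card C - card B"
    using card_Diff_subset_Int[of C H] CH indep_finite[OF B(1)] by simp
  moreover obtain I where I: "I \<in> indep (contraction M H)" "I \<subseteq> Y"
      "card I = mrank (contraction M H) Y"
    using N.ex_basis by blast
  moreover have "mrank M (H \<union> I) \<le> mrank M (H \<union> Y)" using I(2) by (intro mrank_mono) blast
  moreover have "mrank M (H \<union> I) = mrank M H + card I" using I(1) by (simp add: contraction_def)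
  ultimately show ?thesis using B(3) C(4) by simp
qed

end

theory Submission
  imports Defs
begin

text \<open>
  Both inequalities come from submodularity of the rank. For \<open>Y \<subseteq> E - H\<close> it gives
  \<open>r(H \<union> Y) - r(H) \<le> r(Y)\<close>, so contracting \<open>H\<close> makes a set at most as large in rank as deleting
  \<open>H\<close> does. Dually, when \<open>X\<close> is disjoint from \<open>H\<close>, the drop in rank caused by removing \<open>X\<close> is
  \<open>r(E) - r(E - X)\<close> in \<open>M/H\<close> and \<open>r(E - H) - r(E - H - X)\<close> in \<open>M\H\<close>, and the former is at most
  the latter. So passing from \<open>M\H\<close> to \<open>M/H\<close> shrinks the denominators of both quotients, and since
  weights are nonnegative the quotients can only grow while the denominators stay positive.

  For the strength this finishes the argument: a set attaining the minimum for \<open>M/H\<close> competes in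
  \<open>M\H\<close>, with a smaller quotient. For the density there is one obstacle: a set \<open>X\<close> attaining
  the maximum for \<open>M\H\<close> may have rank zero in \<open>M/H\<close>, namely when \<open>X \<subseteq> cl(H)\<close>. Then any element
  \<open>e\<close> outside \<open>cl(H)\<close> is added to \<open>X\<close>. The rank in \<open>M/H\<close> becomes exactly 1, the weight does not
  decrease, and \<open>\<sigma>(X)/r(X) \<le> \<sigma>(X)\<close> because \<open>r(X) \<ge> 1\<close>.
\<close>

context matroid
begin

text \<open>Extend a basis \<open>I\<close> of the intersection to a basis \<open>J\<close> of the union. Then \<open>J\<close> meets the
  intersection in \<open>I\<close> alone, so inclusion-exclusion for the traces of \<open>J\<close> on the two sets counts
  both ranks on the left.\<close>

lemma mrank_submodular:
  "mrank M (A \<union> B) + mrank M (A \<inter> B) \<le> mrank M A + mrank M B"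
proof -
  obtain I where I: "I \<in> indep M" "I \<subseteq> A \<inter> B" "card I = mrank M (A \<inter> B)"
    using ex_basis by blast
  obtain J where J: "J \<in> indep M" "I \<subseteq> J" "J \<subseteq> A \<union> B" "card J = mrank M (A \<union> B)"
    using extend_to_basis[OF I(1), of "A \<union> B"] I(2) by blast
  have fin: "finite (J \<inter> A)" "finite (J \<inter> B)"
    using indep_finite[OF J(1)] by auto
  have un: "(J \<inter> A) \<union> (J \<inter> B) = J"
    using J(3) by blast
  have int: "(J \<inter> A) \<inter> (J \<inter> B) = I"
    using basis_extension_Int[OF I J(1,2)] by blast
  have "card (J \<inter> A) + card (J \<inter> B) = card J + card I"
    using card_Un_Int[OF fin] un int by simp
  moreover have "card (J \<inter> A) \<le> mrank M A" "card (J \<inter> B) \<le> mrank M B"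
    using indep_mono[OF J(1)] by (auto intro!: card_le_mrank)
  ultimately show ?thesis
    using I(3) J(4) by simp
qed

lemma mrank_subadditive: "mrank M (A \<union> B) \<le> mrank M A + mrank M B"
  using mrank_submodular[of A B] by simp

lemma mrank_le_card:
  assumes "finite X"
  shows "mrank M X \<le> card X"
  using ex_basis[of X] card_mono[OF assms] by metis

lemma ex_rank_increasing_element:
  assumes "mclosure M H \<noteq> ground M"
  obtains e where "e \<in> ground M - H" "mrank M (insert e H) = mrank M H + 1"
proof -
  obtain e where e: "e \<in> ground M" "mrank M (insert e H) \<noteq> mrank M H"
    using assms by (auto simp: mclosure_def)
  have "mrank M (insert e H) \<le> mrank M H + 1"
    using mrank_subadditive[of "{e}" H] mrank_le_card[of "{e}"] by simp
  moreover have "mrank M H \<le> mrank M (insert e H)"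
    by (intro mrank_mono) blast
  ultimately have "mrank M (insert e H) = mrank M H + 1"
    using e(2) by simp
  moreover have "e \<notin> H"
    using e(2) by (auto simp: insert_absorb)
  ultimately show ?thesis
    using that e(1) by blast
qed

lemma strength_le:
  assumes "X \<subseteq> ground M" "mrank M (ground M) > mrank M (ground M - X)"
  shows "strength \<sigma> M \<le> sum \<sigma> X / (real (mrank M (ground M)) - real (mrank M (ground M - X)))"
  unfolding strength_def
  by (rule Min_le) (use finite_ground assms in auto)

lemma strength_attained:
  assumes "mrank M (ground M) > 0"
  obtains X where "X \<subseteq> ground M" "mrank M (ground M) > mrank M (ground M - X)"
    "strength \<sigma> M = sum \<sigma> X / (real (mrank M (ground M)) - real (mrank M (ground M - X)))"
proof -
  have "mrank M (ground M - ground M) < mrank M (ground M)"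
    using mrank_le_card[of "{}"] assms by simp
  then have "strength \<sigma> M \<in>
    {sum \<sigma> X / (real (mrank M (ground M)) - real (mrank M (ground M - X))) | X.
       X \<subseteq> ground M \<and> mrank M (ground M) > mrank M (ground M - X)}"
    unfolding strength_def
    by (intro Min_in) (use finite_ground in auto)
  then show ?thesis
    using that by blast
qed

lemma max_density_ge:
  assumes "X \<subseteq> ground M" "mrank M X > 0"
  shows "sum \<sigma> X / real (mrank M X) \<le> max_density \<sigma> M"
  unfolding max_density_def
  by (rule Max_ge) (use finite_ground assms in auto)

lemma max_density_attained:
  assumes "mrank M (ground M) > 0"
  obtains X where "X \<subseteq> ground M" "mrank M X > 0" "max_density \<sigma> M = sum \<sigma> X / real (mrank M X)"
proof -
  have "max_density \<sigma> M \<in> {sum \<sigma> X / real (mrank M X) | X. X \<subseteq> ground M \<and> mrank M X > 0}"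
    unfolding max_density_def
    by (intro Max_in) (use finite_ground assms in auto)
  then show ?thesis
    using that by blast
qed

lemma mrank_contraction_le:
  assumes "Y \<subseteq> ground M - H"
  shows "mrank (contraction M H) Y \<le> mrank M Y"
  using mrank_contraction[OF matroid_axioms assms] mrank_subadditive[of H Y] by simp

lemma contraction_rank_pos:
  assumes "mclosure M H \<noteq> ground M"
  shows "mrank (contraction M H) (ground M - H) > 0"
proof -
  obtain e where e: "e \<in> ground M - H" "mrank M (insert e H) = mrank M H + 1"
    using ex_rank_increasing_element[OF assms] .
  have "mrank M (insert e H) \<le> mrank M (H \<union> (ground M - H))"
    using e(1) by (intro mrank_mono) blast
  then show ?thesis
    using e(2) mrank_contraction[OF matroid_axioms, of "ground M - H" H] by simp
qed

text \<open>In terms of \<open>r\<close> the claim is submodularity for \<open>E - X\<close> and \<open>E - H\<close>, whose union is \<open>E\<close>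
  because \<open>X\<close> and \<open>H\<close> are disjoint.\<close>

lemma rank_drop_contraction_le:
  assumes "H \<subseteq> ground M" "X \<subseteq> ground M - H"
  shows "real (mrank (contraction M H) (ground M - H))
           - real (mrank (contraction M H) (ground M - H - X))
         \<le> real (mrank M (ground M - H)) - real (mrank M (ground M - H - X))"
proof -
  have eqs: "H \<union> (ground M - H) = ground M" "H \<union> (ground M - H - X) = ground M - X"
    "(ground M - X) \<union> (ground M - H) = ground M"
    "(ground M - X) \<inter> (ground M - H) = ground M - H - X"
    using assms by blast+
  have "mrank M H \<le> mrank M (ground M)" "mrank M H \<le> mrank M (ground M - X)"
    using assms by (auto intro!: mrank_mono)
  then have "real (mrank (contraction M H) (ground M - H))
               = real (mrank M (ground M)) - real (mrank M H)"
    "real (mrank (contraction M H) (ground M - H - X))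
               = real (mrank M (ground M - X)) - real (mrank M H)"
    using mrank_contraction[OF matroid_axioms, of "ground M - H" H]
      mrank_contraction[OF matroid_axioms, of "ground M - H - X" H] eqs(1,2)
    by auto
  moreover have "real (mrank M (ground M)) + real (mrank M (ground M - H - X))
      \<le> real (mrank M (ground M - X)) + real (mrank M (ground M - H))"
    using mrank_submodular[of "ground M - X" "ground M - H"] eqs(3,4) by simp
  ultimately show ?thesis
    by simp
qed

lemma strength_deletion_le_contraction:
  assumes nonneg: "\<And>e. e \<in> ground M \<Longrightarrow> \<sigma> e \<ge> 0"
    and H: "H \<subseteq> ground M" "mclosure M H \<noteq> ground M"
  shows "strength \<sigma> (deletion M H) \<le> strength \<sigma> (contraction M H)"
proof -
  interpret D: matroid "deletion M H"
    by (rule matroid_deletion) (rule matroid_axioms)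
  interpret C: matroid "contraction M H"
    by (rule matroid_contraction) (rule matroid_axioms)
  let ?E = "ground M - H"
  have ground: "ground (deletion M H) = ?E" "ground (contraction M H) = ?E"
    by (simp_all add: deletion_def contraction_def)
  have "mrank (contraction M H) ?E > 0"
    by (rule contraction_rank_pos[OF H(2)])
  then obtain X where X: "X \<subseteq> ?E" "mrank (contraction M H) ?E > mrank (contraction M H) (?E - X)"
    "strength \<sigma> (contraction M H) = sum \<sigma> X /
       (real (mrank (contraction M H) ?E) - real (mrank (contraction M H) (?E - X)))"
    by (rule C.strength_attained[of \<sigma>, unfolded ground])
  have drop: "real (mrank (contraction M H) ?E) - real (mrank (contraction M H) (?E - X))
      \<le> real (mrank (deletion M H) ?E) - real (mrank (deletion M H) (?E - X))"
    using rank_drop_contraction_le[OF H(1) X(1)] by (simp add: mrank_deletion)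
  have "sum \<sigma> X \<ge> 0"
    using X(1) nonneg by (intro sum_nonneg) blast
  have "strength \<sigma> (deletion M H) \<le> sum \<sigma> X /
      (real (mrank (deletion M H) ?E) - real (mrank (deletion M H) (?E - X)))"
    using D.strength_le[of X \<sigma>] X(1,2) drop by (simp add: ground)
  also have "\<dots> \<le> strength \<sigma> (contraction M H)"
    unfolding X(3) using drop X(2) \<open>sum \<sigma> X \<ge> 0\<close> by (intro divide_left_mono mult_pos_pos) auto
  finally show ?thesis .
qed

lemma max_density_deletion_le_contraction:
  assumes nonneg: "\<And>e. e \<in> ground M \<Longrightarrow> \<sigma> e \<ge> 0"
    and H: "mclosure M H \<noteq> ground M"
  shows "max_density \<sigma> (deletion M H) \<le> max_density \<sigma> (contraction M H)"
proof -
  interpret D: matroid "deletion M H"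
    by (rule matroid_deletion) (rule matroid_axioms)
  interpret C: matroid "contraction M H"
    by (rule matroid_contraction) (rule matroid_axioms)
  let ?E = "ground M - H"
  have ground: "ground (deletion M H) = ?E" "ground (contraction M H) = ?E"
    by (simp_all add: deletion_def contraction_def)
  have "mrank (deletion M H) ?E > 0"
    using contraction_rank_pos[OF H] mrank_contraction_le[of ?E H]
    by (simp add: mrank_deletion)
  then obtain X where X: "X \<subseteq> ?E" "mrank (deletion M H) X > 0"
    "max_density \<sigma> (deletion M H) = sum \<sigma> X / real (mrank (deletion M H) X)"
    by (rule D.max_density_attained[of \<sigma>, unfolded ground])
  have rX: "mrank (deletion M H) X = mrank M X"
    using X(1) by (rule mrank_deletion)
  have sX: "sum \<sigma> X \<ge> 0"
    using X(1) nonneg by (intro sum_nonneg) blast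
  show ?thesis
  proof (cases "mrank (contraction M H) X > 0")
    case True
    have "max_density \<sigma> (deletion M H) \<le> sum \<sigma> X / real (mrank (contraction M H) X)"
      unfolding X(3) rX using True sX mrank_contraction_le[OF X(1)]
      by (intro divide_left_mono) auto
    also have "\<dots> \<le> max_density \<sigma> (contraction M H)"
      using True X(1) by (intro C.max_density_ge) (auto simp: ground)
    finally show ?thesis .
  next
    case False
    obtain e where e: "e \<in> ?E" "mrank M (insert e H) = mrank M H + 1"
      using ex_rank_increasing_element[OF H] .
    have sub: "insert e X \<subseteq> ?E"
      using e(1) X(1) by blast
    have "mrank (contraction M H) {e} = 1"
      using mrank_contraction[OF matroid_axioms, of "{e}" H] e by simp
    moreover have "mrank (contraction M H) {e} \<le> mrank (contraction M H) (insert e X)"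
      by (intro C.mrank_mono) blast
    moreover have "mrank (contraction M H) (insert e X)
        \<le> mrank (contraction M H) {e} + mrank (contraction M H) X"
      using C.mrank_subadditive[of "{e}" X] by simp
    ultimately have rank1: "mrank (contraction M H) (insert e X) = 1"
      using False by simp
    have "max_density \<sigma> (deletion M H) \<le> sum \<sigma> X / 1"
      unfolding X(3) using X(2) sX by (intro divide_left_mono) auto
    also have "\<dots> \<le> sum \<sigma> (insert e X) / 1"
      using sub nonneg finite_subset[OF sub] finite_ground
      by (auto intro!: sum_mono2)
    also have "\<dots> \<le> max_density \<sigma> (contraction M H)"
      using C.max_density_ge[of "insert e X" \<sigma>] sub rank1 by (simp add: ground)
    finally show ?thesis .
  qed
qed

end

theorem lemma6p3:
  fixes M :: "'a set_system" and \<sigma> :: "'a \<Rightarrow> real"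
  assumes "matroid M"
    and "loopless M"
    and "mrank M (ground M) > 0"
    and "\<forall>e\<in>ground M. \<sigma> e > 0"
  shows "(\<forall>H\<subseteq>ground M. mclosure M H \<noteq> ground M \<longrightarrow>
            strength \<sigma> (deletion M H) \<le> strength \<sigma> (contraction M H)) \<and>
         (\<forall>H\<subseteq>ground M. mclosure M H \<noteq> ground M \<longrightarrow>
            max_density \<sigma> (deletion M H) \<le> max_density \<sigma> (contraction M H))"
proof -
  interpret matroid M by fact
  have "\<sigma> e \<ge> 0" if "e \<in> ground M" for e
    using assms(4) that by (simp add: less_imp_le)
  then show ?thesis
    using strength_deletion_le_contraction max_density_deletion_le_contraction by blast
qed

end
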